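(* Let $A=(B,O,S)$ be a cyclic or acyclic abduction instance. Let $P_{\mathrm{BwdA}}^{G^1}(A)$ be the program obtained from the program $P_{\mathrm{BwdA}}(A)$ (defined in the context) by replacing every body atom of the form $Z_v=s(a,v,Y_1,\dots,Y_m)$ by the external atom $\&sk^{G^1}[a,v,Y_1,\dots,Y_m](Z_v)$. Then the ground instantiation $grnd(P_{\mathrm{BwdA}}^{G^1}(A))$ is finite.
   Context: **Abduction instances.** An abduction instance is a tuple $A=(B,O,S)$. Here $O$ (observation, goal) is an existentially quantified conjunction of atoms $\exists V_1,\dots,V_k: o_1(V_1,\dots,V_k)\wedge\cdots\wedge o_m(V_1,\dots,V_k)$, in which each existential variable $V_i$ is represented by a constant $v_i\notin S$. $B$ is a finite set of axioms, each a single-head Horn clause $$q(Y_1,\dots,Y_m)\Leftarrow p_1(X^1_1,\dots,X^1_{k_1})\wedge\cdots\wedge p_r(X^r_1,\dots,X^r_{k_r}),$$ with body variables $\mathcal X$, head variables $\mathcal Y\subseteq\mathcal X$, universally quantified over $\mathcal X$ (constants may also occur as arguments; they are left unchanged by the rewriting, and only head variables are arguments of Skolem terms). $S$ is a set of constants of $B$ called sort names. Here $B$ may be cyclic, i.e., circular inferences over the axioms are allowed. All atoms in $B$ and $O$ are assumed to have arity 2. **ASP program $P_{\mathrm{BwdA}}(A)=P_{bpt}(A)\cup P_{gp}\cup P_{eq}\cup P_c$.** An atom $p(a,b)$ is represented by the term $c(p,a,b)$. $P_{bpt}(A)$ consists of: the fact $goal(c(o_i,v_1,\dots,v_k))$ for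 each atom of $O$; the fact $sortname(s)$ for each $s\in S$; for each axiom with unique identifier $a$ and $\{Z_1,\dots,Z_v\}=\mathcal X\setminus\mathcal Y$ the rules $$mayInferVia(a,c(q,Y_1,\dots,Y_m),l(Z_1,\dots,Z_v))\leftarrow pot(c(q,Y_1,\dots,Y_m)),\ Z_1=s(a,1,Y_1,\dots,Y_m),\dots,Z_v=s(a,v,Y_1,\dots,Y_m).$$ $$inferenceNeeds(c(q,Y_1,\dots,Y_m),a,c(p_j,X^j_1,\dots,X^j_{k_j}))\leftarrow mayInferVia(a,c(q,Y_1,\dots,Y_m),l(Z_1,\dots,Z_v)).\quad (1\le j\le r)$$ and the rules $pot(X)\leftarrow goal(X).$ and $pot(P)\leftarrow inferenceNeeds(\_,\_,P).$ $P_{gp}$ consists of $$true(P)\leftarrow goal(P).\qquad 1\le\{infer(P);fai(P)\}\le1\leftarrow true(P).$$ $$1\le\{inferVia(R,P): mayInferVia(R,P,\_)\}\le1\leftarrow infer(P).$$ $$true(Q)\leftarrow inferVia(R,P),\ inferenceNeeds(P,R,Q).$$ $P_{eq}$ consists of $$hu(X)\leftarrow pot(c(\_,X,\_)).\qquad hu(X)\leftarrow pot(c(\_,\_,X)).\qquad uhu(X)\leftarrow hu(X),\mathrm{not}\ sortname(X).$$ $$\{eq(A,B): uhu(A),uhu(B),A\neq B\}\leftarrow.\qquad eq(A,A)\leftarrow hu(A).$$ $$\leftarrow eq(A,B),\mathrm{not}\ eq(B,A).\qquad \leftarrow eq(A,B),eq(B,C),A\neq B,B\neq C,A\neq C,\mathrm{not}\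 eq(A,C).$$ $P_c$ consists of $$factorCluster(c(P,S_2,O_2),c(P,S_1,O_1))\leftarrow fa(c(P,S_1,O_1)),fa(c(P,S_2,O_2)),eq(S_1,S_2),c(P,S_1,O_1)<c(P,S_2,O_2),eq(O_1,O_2).$$ $$factorClusterAbove(A)\leftarrow factorCluster(A,\_).$$ $$factorVia(A,B)\leftarrow factorCluster(A,B),\mathrm{not}\ factorClusterAbove(B).$$ $$factor(P)\leftarrow factorVia(P,\_).\qquad abduce(P)\leftarrow fa(P),\mathrm{not}\ factor(P).\qquad fa(P)\leftarrow fai(P).$$ Here $c$, $l$, $s$ are uninterpreted function symbols. **External atoms.** An external atom $\&f[\vec y](\vec x)$ (HEX programs) has its truth value determined by an oracle function $f(I,\vec y,\vec x)\in\{0,1\}$ for interpretation $I$ and ground input/output tuples. The oracle of $\&sk^{G^1}$ satisfies $f(I,R,V,Y_1,\dots,Y_m,Z)=1$ iff $Z=s(R,V,Y_1,\dots,Y_m)$ and no $Y_j$, $1\le j\le m$, has a sub-term (possibly $Y_j$ itself) of the form $s(R,V,\cdots)$. **Instantiation.** $grnd(P)$ is the ground instantiation of $P$ as produced by bottom-up instantiation of safe rules: the ground rule instances whose positive body atoms are derivable (possibly true) and whose external atoms evaluate to true. *)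

theory Defs
  imports Main
begin

section \<open>Syntax of HEX programs\<close>

type_synonym name = String.literal
type_synonym var = String.literal

datatype tm = Var var | Num int | Con name | Fun name "tm list"

datatype gterm = GNum int | GCon name | GFun name "gterm list"

text \<open>The syntax is polymorphic in the terms, so that it serves for non-ground programs
  (over \<^typ>\<open>tm\<close>) as well as for ground programs (over \<^typ>\<open>gterm\<close>).\<close>

datatype 't atom = Atom name "'t list"

datatype cmp = EQ | NEQ | LESS

text \<open>\<open>Ext f ys xs\<close> is the external atom \<open>&f[ys](xs)\<close>.\<close>

datatype 't lit =
    Pos "'t atom"
  | Neg "'t atom"
  | Cmp cmp 't 't
  | Ext name "'t list" "'t list"

text \<open>A choice head \<open>l \<le> {a : L; \<dots>} \<le> u\<close> has optional bounds and a set of elements \<open>(a, L)\<close>. The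
  element set may be infinite in a ground rule, because a single non-ground element is replaced
  by all of its relevant instances.\<close>

datatype 't head =
    Normal "'t atom"
  | Falsum
  | Choice "nat option" "('t atom \<times> 't lit list) set" "nat option"

datatype 't rule = Rule (rule_head: "'t head") (rule_body: "'t lit list")

type_synonym 't program = "'t rule set"

abbreviation normal_rule :: "'t atom \<Rightarrow> 't lit list \<Rightarrow> 't rule"  (infix "\<Leftarrow>" 50)
  where "a \<Leftarrow> L \<equiv> Rule (Normal a) L"


section \<open>Instantiation\<close>

primrec vars_term :: "tm \<Rightarrow> var set" where
  "vars_term (Var x) = {x}"
| "vars_term (Num i) = {}"
| "vars_term (Con k) = {}"
| "vars_term (Fun f ts) = \<Union> (set (map vars_term ts))"

definition vars_lits :: "tm lit list \<Rightarrow> var set" where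
  "vars_lits L = (\<Union>l\<in>set L. \<Union>t\<in>set_lit l. vars_term t)"

primrec inst :: "(var \<Rightarrow> gterm) \<Rightarrow> tm \<Rightarrow> gterm" where
  "inst \<sigma> (Var x) = \<sigma> x"
| "inst \<sigma> (Num i) = GNum i"
| "inst \<sigma> (Con k) = GCon k"
| "inst \<sigma> (Fun f ts) = GFun f (map (inst \<sigma>) ts)"

abbreviation inst_atom :: "(var \<Rightarrow> gterm) \<Rightarrow> tm atom \<Rightarrow> gterm atom" where
  "inst_atom \<sigma> \<equiv> map_atom (inst \<sigma>)"

abbreviation inst_lits :: "(var \<Rightarrow> gterm) \<Rightarrow> tm lit list \<Rightarrow> gterm lit list" where
  "inst_lits \<sigma> \<equiv> map (map_lit (inst \<sigma>))"

text \<open>The ASP-Core-2 total order on ground terms: integers, then symbolic constants, then compound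
  terms, the latter by arity, function symbol and arguments from left to right.\<close>

fun gterm_less :: "gterm \<Rightarrow> gterm \<Rightarrow> bool" and gterms_less :: "gterm list \<Rightarrow> gterm list \<Rightarrow> bool" where
  "gterm_less (GNum i) (GNum j) \<longleftrightarrow> i < j"
| "gterm_less (GNum i) (GCon l) \<longleftrightarrow> True"
| "gterm_less (GNum i) (GFun g us) \<longleftrightarrow> True"
| "gterm_less (GCon k) (GNum j) \<longleftrightarrow> False"
| "gterm_less (GCon k) (GCon l) \<longleftrightarrow> k < l"
| "gterm_less (GCon k) (GFun g us) \<longleftrightarrow> True"
| "gterm_less (GFun f ts) (GNum j) \<longleftrightarrow> False"
| "gterm_less (GFun f ts) (GCon l) \<longleftrightarrow> False"
| "gterm_less (GFun f ts) (GFun g us) \<longleftrightarrow>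
     length ts < length us \<or>
     length ts = length us \<and> (f < g \<or> f = g \<and> gterms_less ts us)"
| "gterms_less (t # ts) (u # us) \<longleftrightarrow> gterm_less t u \<or> t = u \<and> gterms_less ts us"
| "gterms_less _ _ \<longleftrightarrow> False"

fun cmp_holds :: "cmp \<Rightarrow> gterm \<Rightarrow> gterm \<Rightarrow> bool" where
  "cmp_holds EQ t u \<longleftrightarrow> t = u"
| "cmp_holds NEQ t u \<longleftrightarrow> t \<noteq> u"
| "cmp_holds LESS t u \<longleftrightarrow> gterm_less t u"

type_synonym interp = "gterm atom set"

text \<open>\<open>f I ys xs\<close> is the truth value for the interpretation \<open>I\<close>, input \<open>ys\<close> and output \<open>xs\<close>.\<close>

type_synonym oracle_function = "interp \<Rightarrow> gterm list \<Rightarrow> gterm list \<Rightarrow> bool"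

text \<open>\<open>D\<close> is the set of atoms considered possibly true. Default-negated atoms do not restrict the
  instantiation. An external atom whose truth value depends on the interpretation is possibly true
  if it is true for some interpretation.\<close>

fun possible_lit :: "(name \<Rightarrow> oracle_function) \<Rightarrow> gterm atom set \<Rightarrow> gterm lit \<Rightarrow> bool" where
  "possible_lit F D (Pos a) \<longleftrightarrow> a \<in> D"
| "possible_lit F D (Neg a) \<longleftrightarrow> True"
| "possible_lit F D (Cmp r t u) \<longleftrightarrow> cmp_holds r t u"
| "possible_lit F D (Ext f ys xs) \<longleftrightarrow> (\<exists>I. F f I ys xs)"

definition possible :: "(name \<Rightarrow> oracle_function) \<Rightarrow> gterm atom set \<Rightarrow> gterm lit list \<Rightarrow> bool" where
  "possible F D L \<longleftrightarrow> (\<forall>l\<in>set L. possible_lit F D l)"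

text \<open>\<open>G\<close> is the set of global variables of the rule. The remaining variables of a choice element
  are local to it, and are instantiated independently of \<open>\<sigma>\<close>.\<close>

fun inst_head ::
  "(name \<Rightarrow> oracle_function) \<Rightarrow> gterm atom set \<Rightarrow> var set \<Rightarrow> (var \<Rightarrow> gterm) \<Rightarrow> tm head \<Rightarrow> gterm head" where
  "inst_head F D G \<sigma> (Normal a) = Normal (inst_atom \<sigma> a)"
| "inst_head F D G \<sigma> Falsum = Falsum"
| "inst_head F D G \<sigma> (Choice l E u) =
     Choice l {(inst_atom \<tau> a, inst_lits \<tau> L) | a L \<tau>.
                 (a, L) \<in> E \<and> (\<forall>x\<in>G. \<tau> x = \<sigma> x) \<and> possible F D (inst_lits \<tau> L)} u"

definition instances_wrt ::
  "(name \<Rightarrow> oracle_function) \<Rightarrow> gterm atom set \<Rightarrow> tm program \<Rightarrow> gterm program" where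
  "instances_wrt F D P =
     {Rule (inst_head F D (vars_lits L) \<sigma> h) (inst_lits \<sigma> L) | h L \<sigma>.
        Rule h L \<in> P \<and> possible F D (inst_lits \<sigma> L)}"

fun head_atoms :: "'t head \<Rightarrow> 't atom set" where
  "head_atoms (Normal a) = {a}"
| "head_atoms Falsum = {}"
| "head_atoms (Choice l E u) = fst ` E"

definition derivable :: "(name \<Rightarrow> oracle_function) \<Rightarrow> tm program \<Rightarrow> gterm atom set" where
  "derivable F P = lfp (\<lambda>D. \<Union>r\<in>instances_wrt F D P. head_atoms (rule_head r))"

definition grnd :: "(name \<Rightarrow> oracle_function) \<Rightarrow> tm program \<Rightarrow> gterm program" where
  "grnd F P = instances_wrt F (derivable F P) P"

text \<open>Finiteness of a program includes finiteness of its rules, whose bodies are lists but whose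
  choice heads may have infinitely many elements.\<close>

fun finite_head :: "'t head \<Rightarrow> bool" where
  "finite_head (Normal a) \<longleftrightarrow> True"
| "finite_head Falsum \<longleftrightarrow> True"
| "finite_head (Choice l E u) \<longleftrightarrow> finite E"

definition finite_program :: "'t program \<Rightarrow> bool" where
  "finite_program P \<longleftrightarrow> finite P \<and> (\<forall>r\<in>P. finite_head (rule_head r))"

lemma possible_mono:
  assumes "D \<subseteq> D'" and "possible F D L"
  shows "possible F D' L"
  unfolding possible_def
proof
  fix l assume "l \<in> set L"
  with assms(2) have "possible_lit F D l" by (simp add: possible_def)
  with assms(1) show "possible_lit F D' l" by (cases l) auto
qed

lemma mono_derivation_step:
  "mono (\<lambda>D. \<Union>r\<in>instances_wrt F D P. head_atoms (rule_head r))"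
proof (intro monoI subsetI)
  fix D D' :: "gterm atom set" and a
  assume D: "D \<subseteq> D'"
    and "a \<in> (\<Union>r\<in>instances_wrt F D P. head_atoms (rule_head r))"
  then obtain h L \<sigma> where r: "Rule h L \<in> P" "possible F D (inst_lits \<sigma> L)"
    and a: "a \<in> head_atoms (inst_head F D (vars_lits L) \<sigma> h)"
    unfolding instances_wrt_def by auto
  have "Rule (inst_head F D' (vars_lits L) \<sigma> h) (inst_lits \<sigma> L) \<in> instances_wrt F D' P"
    unfolding instances_wrt_def using r(1) possible_mono[OF D r(2)] by blast
  moreover have "a \<in> head_atoms (inst_head F D' (vars_lits L) \<sigma> h)"
  proof (cases h)
    case (Choice l E u)
    with a obtain b M \<tau> where "a = inst_atom \<tau> b" "(b, M) \<in> E"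
      "\<forall>x\<in>vars_lits L. \<tau> x = \<sigma> x" "possible F D (inst_lits \<tau> M)"
      by auto
    with possible_mono[OF D] Choice show ?thesis
      by (simp add: image_iff) blast
  qed (use a in auto)
  ultimately show "a \<in> (\<Union>r\<in>instances_wrt F D' P. head_atoms (rule_head r))"
    by force
qed


section \<open>Abduction instances\<close>

datatype arg = ArgVar var | ArgCon name

datatype fo_atom = FOAtom (pred: name) (args: "arg list")

definition vars_fo :: "fo_atom \<Rightarrow> var set" where
  "vars_fo p = {x. ArgVar x \<in> set (args p)}"

definition cons_fo :: "fo_atom \<Rightarrow> name set" where
  "cons_fo p = {k. ArgCon k \<in> set (args p)}"

record horn_clause =
  ident :: name
  hc_head :: fo_atom
  hc_body :: "fo_atom list"

definition vars_body :: "horn_clause \<Rightarrow> var set" where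
  "vars_body ax = (\<Union>p\<in>set (hc_body ax). vars_fo p)"

definition cons_axiom :: "horn_clause \<Rightarrow> name set" where
  "cons_axiom ax = (\<Union>p\<in>insert (hc_head ax) (set (hc_body ax)). cons_fo p)"

text \<open>The variables of the observation are read as existentially quantified; \<open>ex_const\<close> is the
  representation of these variables by constants.\<close>

record abduction_tuple =
  axioms :: "horn_clause set"
  observation :: "fo_atom list"
  ex_const :: "var \<Rightarrow> name"
  sort_names :: "name set"

definition abduction_instance :: "abduction_tuple \<Rightarrow> bool" where
  "abduction_instance A \<longleftrightarrow>
     finite (axioms A) \<and>
     inj_on ident (axioms A) \<and>
     (\<forall>ax\<in>axioms A. vars_fo (hc_head ax) \<subseteq> vars_body ax) \<and>
     sort_names A \<subseteq> (\<Union>ax\<in>axioms A. cons_axiom ax) \<and>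
     (\<forall>p\<in>set (observation A). \<forall>x\<in>vars_fo p. ex_const A x \<notin> sort_names A)"

definition binary_atoms :: "abduction_tuple \<Rightarrow> bool" where
  "binary_atoms A \<longleftrightarrow>
     (\<forall>ax\<in>axioms A. \<forall>p\<in>insert (hc_head ax) (set (hc_body ax)). length (args p) = 2) \<and>
     (\<forall>p\<in>set (observation A). length (args p) = 2)"


section \<open>The program for backward chaining abduction\<close>

fun arg_term :: "arg \<Rightarrow> tm" where
  "arg_term (ArgVar x) = Var x"
| "arg_term (ArgCon k) = Con k"

fun goal_arg :: "(var \<Rightarrow> name) \<Rightarrow> arg \<Rightarrow> tm" where
  "goal_arg v (ArgVar x) = Con (v x)"
| "goal_arg v (ArgCon k) = Con k"

definition enc :: "fo_atom \<Rightarrow> tm" where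
  "enc p = Fun STR ''c'' (Con (pred p) # map arg_term (args p))"

definition enc_goal :: "(var \<Rightarrow> name) \<Rightarrow> fo_atom \<Rightarrow> tm" where
  "enc_goal v p = Fun STR ''c'' (Con (pred p) # map (goal_arg v) (args p))"

definition arg_vars :: "fo_atom \<Rightarrow> var list" where
  "arg_vars p = concat (map (\<lambda>a. case a of ArgVar x \<Rightarrow> [x] | ArgCon k \<Rightarrow> []) (args p))"

text \<open>The enumeration \<open>Z\<^sub>1, \<dots>, Z\<^sub>v\<close>, without repetition, of the body variables that do not occur
  in the head.\<close>

definition ex_vars :: "horn_clause \<Rightarrow> var list" where
  "ex_vars ax = remdups (filter (\<lambda>x. x \<notin> vars_fo (hc_head ax)) (concat (map arg_vars (hc_body ax))))"

text \<open>\<open>s(a, i, Y\<^sub>1, \<dots>, Y\<^sub>m)\<close>, where the \<open>Y\<^sub>j\<close> are the variables at the argument positions of the head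
  (with repetitions); constants in the head are not arguments of Skolem terms.\<close>

definition skolem_term :: "horn_clause \<Rightarrow> nat \<Rightarrow> tm" where
  "skolem_term ax i =
     Fun STR ''s'' (Con (ident ax) # Num (int i) # map Var (arg_vars (hc_head ax)))"

definition may_infer_via :: "horn_clause \<Rightarrow> tm atom" where
  "may_infer_via ax =
     Atom STR ''mayInferVia''
       [Con (ident ax), enc (hc_head ax), Fun STR ''l'' (map Var (ex_vars ax))]"

definition axiom_rules :: "horn_clause \<Rightarrow> tm program" where
  "axiom_rules ax =
     {may_infer_via ax \<Leftarrow>
        Pos (Atom STR ''pot'' [enc (hc_head ax)]) #
        map (\<lambda>i. Cmp EQ (Var (ex_vars ax ! i)) (skolem_term ax (i + 1))) [0..<length (ex_vars ax)]} \<union>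
     {Atom STR ''inferenceNeeds'' [enc (hc_head ax), Con (ident ax), enc p] \<Leftarrow>
        [Pos (may_infer_via ax)] | p. p \<in> set (hc_body ax)}"

text \<open>In the fixed rules below, the variables \<open>_1\<close> and \<open>_2\<close> are the anonymous variables.\<close>

definition P_bpt :: "abduction_tuple \<Rightarrow> tm program" where
  "P_bpt A =
     {Atom STR ''goal'' [enc_goal (ex_const A) p] \<Leftarrow> [] | p. p \<in> set (observation A)} \<union>
     {Atom STR ''sortname'' [Con k] \<Leftarrow> [] | k. k \<in> sort_names A} \<union>
     (\<Union>ax\<in>axioms A. axiom_rules ax) \<union>
     {Atom STR ''pot'' [Var STR ''X''] \<Leftarrow> [Pos (Atom STR ''goal'' [Var STR ''X''])],
      Atom STR ''pot'' [Var STR ''P''] \<Leftarrow>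
        [Pos (Atom STR ''inferenceNeeds'' [Var STR ''_1'', Var STR ''_2'', Var STR ''P''])]}"

definition P_gp :: "tm program" where
  "P_gp =
     {Atom STR ''true'' [Var STR ''P''] \<Leftarrow> [Pos (Atom STR ''goal'' [Var STR ''P''])],
      Rule
        (Choice (Some 1)
          {(Atom STR ''infer'' [Var STR ''P''], []), (Atom STR ''fai'' [Var STR ''P''], [])}
          (Some 1))
        [Pos (Atom STR ''true'' [Var STR ''P''])],
      Rule
        (Choice (Some 1)
          {(Atom STR ''inferVia'' [Var STR ''R'', Var STR ''P''],
            [Pos (Atom STR ''mayInferVia'' [Var STR ''R'', Var STR ''P'', Var STR ''_1''])])}
          (Some 1))
        [Pos (Atom STR ''infer'' [Var STR ''P''])],
      Atom STR ''true'' [Var STR ''Q''] \<Leftarrow>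
        [Pos (Atom STR ''inferVia'' [Var STR ''R'', Var STR ''P'']),
         Pos (Atom STR ''inferenceNeeds'' [Var STR ''P'', Var STR ''R'', Var STR ''Q''])]}"

definition P_eq :: "tm program" where
  "P_eq =
     {Atom STR ''hu'' [Var STR ''X''] \<Leftarrow>
        [Pos (Atom STR ''pot'' [Fun STR ''c'' [Var STR ''_1'', Var STR ''X'', Var STR ''_2'']])],
      Atom STR ''hu'' [Var STR ''X''] \<Leftarrow>
        [Pos (Atom STR ''pot'' [Fun STR ''c'' [Var STR ''_1'', Var STR ''_2'', Var STR ''X'']])],
      Atom STR ''uhu'' [Var STR ''X''] \<Leftarrow>
        [Pos (Atom STR ''hu'' [Var STR ''X'']), Neg (Atom STR ''sortname'' [Var STR ''X''])],
      Rule
        (Choice None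
          {(Atom STR ''eq'' [Var STR ''A'', Var STR ''B''],
            [Pos (Atom STR ''uhu'' [Var STR ''A'']),
             Pos (Atom STR ''uhu'' [Var STR ''B'']),
             Cmp NEQ (Var STR ''A'') (Var STR ''B'')])}
          None)
        [],
      Atom STR ''eq'' [Var STR ''A'', Var STR ''A''] \<Leftarrow> [Pos (Atom STR ''hu'' [Var STR ''A''])],
      Rule Falsum
        [Pos (Atom STR ''eq'' [Var STR ''A'', Var STR ''B'']),
         Neg (Atom STR ''eq'' [Var STR ''B'', Var STR ''A''])],
      Rule Falsum
        [Pos (Atom STR ''eq'' [Var STR ''A'', Var STR ''B'']),
         Pos (Atom STR ''eq'' [Var STR ''B'', Var STR ''C'']),
         Cmp NEQ (Var STR ''A'') (Var STR ''B''),
         Cmp NEQ (Var STR ''B'') (Var STR ''C''),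
         Cmp NEQ (Var STR ''A'') (Var STR ''C''),
         Neg (Atom STR ''eq'' [Var STR ''A'', Var STR ''C''])]}"

definition P_c :: "tm program" where
  "P_c =
    (let c1 = Fun STR ''c'' [Var STR ''P'', Var STR ''S1'', Var STR ''O1''];
         c2 = Fun STR ''c'' [Var STR ''P'', Var STR ''S2'', Var STR ''O2'']
     in
     {Atom STR ''factorCluster'' [c2, c1] \<Leftarrow>
        [Pos (Atom STR ''fa'' [c1]),
         Pos (Atom STR ''fa'' [c2]),
         Pos (Atom STR ''eq'' [Var STR ''S1'', Var STR ''S2'']),
         Cmp LESS c1 c2,
         Pos (Atom STR ''eq'' [Var STR ''O1'', Var STR ''O2''])],
      Atom STR ''factorClusterAbove'' [Var STR ''A''] \<Leftarrow>
        [Pos (Atom STR ''factorCluster'' [Var STR ''A'', Var STR ''_1''])],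
      Atom STR ''factorVia'' [Var STR ''A'', Var STR ''B''] \<Leftarrow>
        [Pos (Atom STR ''factorCluster'' [Var STR ''A'', Var STR ''B'']),
         Neg (Atom STR ''factorClusterAbove'' [Var STR ''B''])],
      Atom STR ''factor'' [Var STR ''P''] \<Leftarrow>
        [Pos (Atom STR ''factorVia'' [Var STR ''P'', Var STR ''_1''])],
      Atom STR ''abduce'' [Var STR ''P''] \<Leftarrow>
        [Pos (Atom STR ''fa'' [Var STR ''P'']), Neg (Atom STR ''factor'' [Var STR ''P''])],
      Atom STR ''fa'' [Var STR ''P''] \<Leftarrow> [Pos (Atom STR ''fai'' [Var STR ''P''])]})"

definition P_BwdA :: "abduction_tuple \<Rightarrow> tm program" where
  "P_BwdA A = P_bpt A \<union> P_gp \<union> P_eq \<union> P_c"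


section \<open>Limiting value invention\<close>

fun replace_skolem :: "name \<Rightarrow> tm lit \<Rightarrow> tm lit" where
  "replace_skolem f (Cmp EQ (Var z) (Fun g ts)) =
     (if g = STR ''s'' then Ext f ts [Var z] else Cmp EQ (Var z) (Fun g ts))"
| "replace_skolem f l = l"

definition externalize_skolem :: "name \<Rightarrow> tm program \<Rightarrow> tm program" where
  "externalize_skolem f P = (\<lambda>r. Rule (rule_head r) (map (replace_skolem f) (rule_body r))) ` P"

definition P_BwdA_G1 :: "abduction_tuple \<Rightarrow> tm program" where
  "P_BwdA_G1 A = externalize_skolem STR ''sk_G1'' (P_BwdA A)"

primrec subterms :: "gterm \<Rightarrow> gterm set" where
  "subterms (GNum i) = {GNum i}"
| "subterms (GCon k) = {GCon k}"
| "subterms (GFun f ts) = insert (GFun f ts) (\<Union> (set (map subterms ts)))"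

fun sk_G1 :: oracle_function where
  "sk_G1 I (R # V # Ys) [Z] \<longleftrightarrow>
     Z = GFun STR ''s'' (R # V # Ys) \<and>
     (\<forall>Y\<in>set Ys. \<nexists>ts. GFun STR ''s'' (R # V # ts) \<in> subterms Y)"
| "sk_G1 I _ _ \<longleftrightarrow> False"

definition oracles :: "name \<Rightarrow> oracle_function" where
  "oracles f = (if f = STR ''sk_G1'' then sk_G1 else (\<lambda>I ys xs. False))"

end

theory Submission
  imports Defs
begin

text \<open>The oracle of \<open>sk_G1\<close> never applies the symbol \<open>s(a, v, _)\<close> above another occurrence of
  itself. As there are finitely many pairs \<open>(a, v)\<close>, the nesting depth of derivable Skolem terms is
  bounded, so only finitely many of them exist. Together with the \<open>c\<close>- and \<open>l\<close>-terms over them and the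
  axiom identifiers they form a finite set of arguments that every rule preserves; hence there are
  finitely many derivable atoms. Every rule variable occurs in a positive body atom or in the head
  atom, both of which are derivable in a ground instance, which leaves finitely many instances.\<close>

section \<open>Finite instantiations\<close>

definition vars_atom :: "tm atom \<Rightarrow> var set" where
  "vars_atom a = (\<Union>t\<in>set_atom a. vars_term t)"

definition pos_args :: "'t lit list \<Rightarrow> 't set" where
  "pos_args L = (\<Union>a\<in>{a. Pos a \<in> set L}. set_atom a)"

definition pos_vars :: "tm lit list \<Rightarrow> var set" where
  "pos_vars L = (\<Union>t\<in>pos_args L. vars_term t)"

lemma vars_atom_simps [simp]: "vars_atom (Atom p ts) = (\<Union>t\<in>set ts. vars_term t)"
  by (simp add: vars_atom_def)

lemma vars_lits_simps [simp]:
  "vars_lits [] = {}"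
  "vars_lits (l # L) = (\<Union>t\<in>set_lit l. vars_term t) \<union> vars_lits L"
  "vars_lits (L @ M) = vars_lits L \<union> vars_lits M"
  by (auto simp: vars_lits_def)

lemma pos_args_simps [simp]:
  "pos_args [] = {}"
  "pos_args (Pos a # L) = set_atom a \<union> pos_args L"
  "pos_args (Neg a # L) = pos_args L"
  "pos_args (Cmp r t u # L) = pos_args L"
  "pos_args (Ext f ys xs # L) = pos_args L"
  "pos_args (L @ M) = pos_args L \<union> pos_args M"
  by (auto simp: pos_args_def)

lemma possible_simps [simp]:
  "possible F D []"
  "possible F D (l # L) \<longleftrightarrow> possible_lit F D l \<and> possible F D L"
  "possible F D (L @ M) \<longleftrightarrow> possible F D L \<and> possible F D M"
  by (auto simp: possible_def)

text \<open>In place of the binding of variables by external atoms, this asks for their occurrence in the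
  head: the head atom of an instance is derivable as well.\<close>

fun weakly_safe :: "tm rule \<Rightarrow> bool" where
  "weakly_safe (Rule (Normal a) L) \<longleftrightarrow> vars_lits L \<subseteq> vars_atom a \<union> pos_vars L"
| "weakly_safe (Rule Falsum L) \<longleftrightarrow> vars_lits L \<subseteq> pos_vars L"
| "weakly_safe (Rule (Choice l E u) L) \<longleftrightarrow> finite E \<and> vars_lits L \<subseteq> pos_vars L \<and>
     (\<forall>(a, M)\<in>E. vars_lits M \<subseteq> vars_atom a \<union> pos_vars (L @ M))"

text \<open>A choice element together with the body of its rule acts as a normal rule, because the
  instantiation of the element agrees with that of the body on the global variables.\<close>

fun clauses :: "tm rule \<Rightarrow> (tm atom \<times> tm lit list) set" where
  "clauses (Rule (Normal a) L) = {(a, L)}"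
| "clauses (Rule Falsum L) = {}"
| "clauses (Rule (Choice l E u) L) = (\<lambda>(a, M). (a, L @ M)) ` E"

section \<open>Dependence of instances on the values of finitely many variables\<close>

lemma inst_cong: "(\<And>x. x \<in> vars_term t \<Longrightarrow> \<sigma> x = \<tau> x) \<Longrightarrow> inst \<sigma> t = inst \<tau> t"
  by (induction t) auto

lemma inst_atom_cong: "(\<And>x. x \<in> vars_atom a \<Longrightarrow> \<sigma> x = \<tau> x) \<Longrightarrow> inst_atom \<sigma> a = inst_atom \<tau> a"
  unfolding vars_atom_def by (intro atom.map_cong refl inst_cong) auto

lemma inst_lits_cong:
  assumes "\<And>x. x \<in> vars_lits L \<Longrightarrow> \<sigma> x = \<tau> x"
  shows "inst_lits \<sigma> L = inst_lits \<tau> L"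
proof (intro map_cong refl lit.map_cong inst_cong)
  fix l t x assume "l \<in> set L" "t \<in> set_lit l" "x \<in> vars_term t"
  then show "\<sigma> x = \<tau> x" by (intro assms) (auto simp: vars_lits_def)
qed

text \<open>The elements of a choice head are instantiated by their own \<tau>, which the outer
  substitution constrains only on \<open>G\<close>. Hence agreement on head variables is demanded
  for normal heads only.\<close>

lemma inst_head_cong:
  assumes "\<And>x. x \<in> G \<Longrightarrow> \<sigma> x = \<tau> x" and "\<And>a x. h = Normal a \<Longrightarrow> x \<in> vars_atom a \<Longrightarrow> \<sigma> x = \<tau> x"
  shows "inst_head F D G \<sigma> h = inst_head F D G \<tau> h"
proof (cases h)
  case (Normal a)
  then show ?thesis using assms(2) by (auto intro: inst_atom_cong)
next
  case (Choice l E u)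
  have "(\<forall>x\<in>G. \<rho> x = \<sigma> x) \<longleftrightarrow> (\<forall>x\<in>G. \<rho> x = \<tau> x)" for \<rho> using assms(1) by auto
  then show ?thesis using Choice by simp
qed auto

lemma self_in_subterms [simp]: "t \<in> subterms t"
  by (cases t) auto

lemma finite_subterms [simp]: "finite (subterms t)"
  by (induction t) auto

lemma inst_var_in_subterms: "x \<in> vars_term t \<Longrightarrow> \<sigma> x \<in> subterms (inst \<sigma> t)"
  by (induction t) auto

lemma finite_vars_term: "finite (vars_term t)"
  by (induction t) auto

lemma finite_set_atom [simp]: "finite (set_atom a)"
  by (cases a) simp

lemma finite_set_lit [simp]: "finite (set_lit l)"
  by (cases l) auto

lemma finite_vars_atom: "finite (vars_atom a)"
  by (auto simp: vars_atom_def finite_vars_term)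

lemma finite_vars_lits: "finite (vars_lits L)"
  by (auto simp: vars_lits_def finite_vars_term)

text \<open>Substitutions are total functions, so infinitely many may agree on \<open>V\<close>.
  Resetting them to \<open>undefined\<close> outside \<open>V\<close> leaves the value of
  \<open>f\<close> unchanged and turns them into one of finitely many functions.\<close>

lemma finite_image_restricted_functions:
  assumes "finite V" and "finite U"
    and "\<And>\<sigma> \<tau>. (\<And>x. x \<in> V \<Longrightarrow> \<sigma> x = \<tau> x) \<Longrightarrow> f \<sigma> = f \<tau>"
  shows "finite {f \<sigma> | \<sigma>. \<sigma> ` V \<subseteq> U}"
proof -
  let ?S = "{\<sigma>. \<forall>x. (x \<in> V \<longrightarrow> \<sigma> x \<in> U) \<and> (x \<notin> V \<longrightarrow> \<sigma> x = undefined)}"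
  have "{f \<sigma> | \<sigma>. \<sigma> ` V \<subseteq> U} \<subseteq> f ` ?S"
  proof clarify
    fix \<sigma> assume "\<sigma> ` V \<subseteq> U"
    then have "(\<lambda>x. if x \<in> V then \<sigma> x else undefined) \<in> ?S" by auto
    moreover have "f \<sigma> = f (\<lambda>x. if x \<in> V then \<sigma> x else undefined)" by (rule assms(3)) simp
    ultimately show "f \<sigma> \<in> f ` ?S" by blast
  qed
  moreover have "finite ?S" using assms(1,2) by (rule finite_set_of_finite_funs)
  ultimately show ?thesis by (meson finite_imageI finite_subset)
qed

section \<open>Derivability in terms of clauses\<close>

lemma head_instance_clause:
  assumes "r \<in> instances_wrt F D P" and "a \<in> head_atoms (rule_head r)"
  obtains r' b L \<tau> where "r' \<in> P" "(b, L) \<in> clauses r'" "a = inst_atom \<tau> b"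
    "possible F D (inst_lits \<tau> L)"
proof -
  from assms(1) obtain h L \<sigma> where r: "Rule h L \<in> P" "possible F D (inst_lits \<sigma> L)"
    "r = Rule (inst_head F D (vars_lits L) \<sigma> h) (inst_lits \<sigma> L)"
    unfolding instances_wrt_def by auto
  show thesis
  proof (cases h)
    case (Normal b)
    then show ?thesis using r assms(2) that[of "Rule h L" b L \<sigma>] by auto
  next
    case Falsum
    then show ?thesis using r assms(2) by auto
  next
    case (Choice l E u)
    with r assms(2) obtain b M \<tau> where \<tau>: "a = inst_atom \<tau> b" "(b, M) \<in> E"
      "\<forall>x\<in>vars_lits L. \<tau> x = \<sigma> x" "possible F D (inst_lits \<tau> M)"
      by auto
    \<comment> \<open>Agreement on the global variables keeps the rule body possible under the
      substitution of the element, so \<tau> alone instantiates the combined body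
      \<open>L @ M\<close>.\<close>
    have "inst_lits \<tau> L = inst_lits \<sigma> L" using \<tau>(3) by (intro inst_lits_cong) auto
    then show ?thesis
      using r(1,2) \<tau>(1,4) Choice image_eqI[OF _ \<tau>(2), of "(b, L @ M)" "\<lambda>(a, M). (a, L @ M)"]
      by (intro that[of "Rule h L" b "L @ M" \<tau>]) (simp_all del: map_eq_conv)
  qed
qed

lemma derivable_unfold:
  "derivable F P = (\<Union>r\<in>instances_wrt F (derivable F P) P. head_atoms (rule_head r))"
  unfolding derivable_def by (rule lfp_unfold[OF mono_derivation_step])

text \<open>The derivable atoms form a fixed point. For a choice element, \<tau> serves both as the
  substitution of the rule and as that of the element.\<close>

lemma clause_derivable:
  assumes "r \<in> P" and "(b, L) \<in> clauses r" and "possible F (derivable F P) (inst_lits \<tau> L)"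
  shows "inst_atom \<tau> b \<in> derivable F P"
proof -
  obtain h M where r: "r = Rule h M" by (cases r)
  have "possible F (derivable F P) (inst_lits \<tau> M)"
    using assms r by (cases h) auto
  then have "Rule (inst_head F (derivable F P) (vars_lits M) \<tau> h) (inst_lits \<tau> M)
      \<in> instances_wrt F (derivable F P) P"
    using assms(1) r unfolding instances_wrt_def by blast
  moreover have "inst_atom \<tau> b \<in> head_atoms (inst_head F (derivable F P) (vars_lits M) \<tau> h)"
    using assms(2,3) r by (cases h) (force simp: image_iff)+
  ultimately show ?thesis by (subst derivable_unfold) force
qed

text \<open>A set closed under all clauses is a pre-fixed point of the derivation step, hence
  contains the least fixed point. This is the induction principle for derivable atoms.\<close>

lemma derivable_subset:
  assumes "\<And>r b L \<tau>. r \<in> P \<Longrightarrow> (b, L) \<in> clauses r \<Longrightarrow> possible F D (inst_lits \<tau> L)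
    \<Longrightarrow> inst_atom \<tau> b \<in> D"
  shows "derivable F P \<subseteq> D"
  unfolding derivable_def
proof (rule lfp_lowerbound, rule subsetI)
  fix a assume "a \<in> (\<Union>r\<in>instances_wrt F D P. head_atoms (rule_head r))"
  then show "a \<in> D" by (auto elim!: head_instance_clause intro: assms)
qed

section \<open>Finiteness of the derivable atoms and of the grounding\<close>

lemma possible_pos_args:
  "possible F D (inst_lits \<sigma> L) \<Longrightarrow> t \<in> pos_args L \<Longrightarrow> inst \<sigma> t \<in> (\<Union>a\<in>D. set_atom a)"
proof -
  assume p: "possible F D (inst_lits \<sigma> L)" and "t \<in> pos_args L"
  then obtain a where a: "Pos a \<in> set L" "t \<in> set_atom a"
    by (auto simp: pos_args_def)
  then have "possible_lit F D (map_lit (inst \<sigma>) (Pos a))"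
    using p unfolding possible_def by (metis image_eqI set_map)
  then show "inst \<sigma> t \<in> (\<Union>a\<in>D. set_atom a)"
    using a(2) by (intro UN_I[of "inst_atom \<sigma> a"]) (simp_all add: atom.set_map)
qed

lemma finite_derivable:
  assumes "finite P" and "\<And>r. r \<in> P \<Longrightarrow> weakly_safe r" and "finite W"
    and W: "derivable F P \<subseteq> {a. set_atom a \<subseteq> W}"
  shows "finite (derivable F P)"
proof -
  let ?B = "\<Union>r\<in>P. fst ` clauses r"
  \<comment> \<open>A derivable atom has the predicate and the arity of one of the finitely many
    clause heads. The arity must be recorded, since otherwise argument lists over \<open>W\<close>
    could be arbitrarily long.\<close>
  let ?S = "\<Union>b\<in>?B. case b of Atom p us \<Rightarrow> Atom p ` {ts. set ts \<subseteq> W \<and> length ts = length us}"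
  have "finite (clauses r)" if "r \<in> P" for r
    using assms(2)[OF that] by (cases r rule: clauses.cases) auto
  then have "finite ?S"
    using assms(1,3) by (auto split: atom.split intro!: finite_lists_length_eq)
  moreover have "derivable F P \<subseteq> ?S"
  proof
    fix a assume a: "a \<in> derivable F P"
    then obtain r where r: "r \<in> instances_wrt F (derivable F P) P" "a \<in> head_atoms (rule_head r)"
      by (subst (asm) derivable_unfold) auto
    obtain r' b L \<tau> where b: "r' \<in> P" "(b, L) \<in> clauses r'" "a = inst_atom \<tau> b"
      by (rule head_instance_clause[OF r])
    obtain p us where bp: "b = Atom p us" by (cases b)
    have "set_atom a \<subseteq> W" using W a by blast
    then have "set (map (inst \<tau>) us) \<subseteq> W" using b(3) bp by simp
    then have "a \<in> (case b of Atom p us \<Rightarrow> Atom p ` {ts. set ts \<subseteq> W \<and> length ts = length us})"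
      using b(3) bp by auto
    then show "a \<in> ?S" using b(1,2) by force
  qed
  ultimately show ?thesis by (rule finite_subset[rotated])
qed

text \<open>Weak safety forces all relevant variables to take values in one finite set
  \<open>U\<close>. This is applied twice: to whole rules, and to the elements of each choice
  head.\<close>

lemma finite_program_grnd:
  assumes "finite P" and safe: "\<And>r. r \<in> P \<Longrightarrow> weakly_safe r" and "finite (derivable F P)"
  shows "finite_program (grnd F P)"
proof -
  let ?D = "derivable F P"
  \<comment> \<open>Subterms are included because variables also occur below function symbols such
    as \<open>c\<close> and \<open>l\<close>.\<close>
  define U where "U = (\<Union>a\<in>?D. \<Union>t\<in>set_atom a. subterms t)"
  have U: "finite U" using assms(3) by (auto simp: U_def)
  have atomU: "\<sigma> ` vars_atom a \<subseteq> U" if "inst_atom \<sigma> a \<in> ?D" for a \<sigma>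
  proof clarify
    fix x assume "x \<in> vars_atom a"
    then obtain t where t: "t \<in> set_atom a" "x \<in> vars_term t" by (auto simp: vars_atom_def)
    then have "\<sigma> x \<in> subterms (inst \<sigma> t)" "inst \<sigma> t \<in> set_atom (inst_atom \<sigma> a)"
      by (simp_all add: inst_var_in_subterms atom.set_map)
    then show "\<sigma> x \<in> U" using that unfolding U_def by blast
  qed
  have posU: "\<sigma> ` pos_vars L \<subseteq> U" if "possible F ?D (inst_lits \<sigma> L)" for L \<sigma>
  proof clarify
    fix x assume "x \<in> pos_vars L"
    then obtain t where t: "t \<in> pos_args L" "x \<in> vars_term t" by (auto simp: pos_vars_def)
    then have "\<sigma> x \<in> subterms (inst \<sigma> t)" "inst \<sigma> t \<in> (\<Union>a\<in>?D. set_atom a)"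
      using possible_pos_args[OF that] by (simp_all add: inst_var_in_subterms)
    then show "\<sigma> x \<in> U" unfolding U_def by blast
  qed
  \<comment> \<open>\<open>V\<close> collects the variables that determine the instance of the rule.
    The local variables of a choice head are left out, as they are bound within its set of
    elements.\<close>
  have "\<exists>V. finite V \<and> vars_lits L \<subseteq> V \<and> (\<forall>a. h = Normal a \<longrightarrow> vars_atom a \<subseteq> V) \<and>
      (\<forall>\<sigma>. possible F ?D (inst_lits \<sigma> L) \<longrightarrow> \<sigma> ` V \<subseteq> U)" if r: "Rule h L \<in> P" for h L
  proof (cases h)
    case (Normal a)
    have "\<sigma> ` (vars_atom a \<union> vars_lits L) \<subseteq> U" if "possible F ?D (inst_lits \<sigma> L)" for \<sigma>
    proof -
      \<comment> \<open>A possible body makes the head instance derivable, which bounds the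
        variables that no positive body atom binds.\<close>
      have "inst_atom \<sigma> a \<in> ?D" using r Normal that by (auto intro: clause_derivable)
      moreover have "vars_lits L \<subseteq> vars_atom a \<union> pos_vars L" using safe[OF r] Normal by simp
      ultimately show ?thesis using atomU[of \<sigma> a] posU[OF that] by blast
    qed
    then show ?thesis
      using Normal by (intro exI[of _ "vars_atom a \<union> vars_lits L"])
        (auto simp: finite_vars_atom finite_vars_lits)
  next
    case Falsum
    then have "vars_lits L \<subseteq> pos_vars L" using safe[OF r] by simp
    then show ?thesis
      using Falsum posU[of _ L] finite_vars_lits[of L] by (intro exI[of _ "vars_lits L"]) blast
  next
    case (Choice l E u)
    then have "vars_lits L \<subseteq> pos_vars L" using safe[OF r] by simp
    then show ?thesis
      using Choice posU[of _ L] finite_vars_lits[of L] by (intro exI[of _ "vars_lits L"]) blast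
  qed
  then obtain V where V: "\<And>h L. Rule h L \<in> P \<Longrightarrow> finite (V h L) \<and> vars_lits L \<subseteq> V h L \<and>
      (\<forall>a. h = Normal a \<longrightarrow> vars_atom a \<subseteq> V h L) \<and>
      (\<forall>\<sigma>. possible F ?D (inst_lits \<sigma> L) \<longrightarrow> \<sigma> ` V h L \<subseteq> U)"
    by metis
  let ?f = "\<lambda>h L \<sigma>. Rule (inst_head F ?D (vars_lits L) \<sigma> h) (inst_lits \<sigma> L)"
  let ?I = "\<lambda>r. case r of Rule h L \<Rightarrow> {?f h L \<sigma> | \<sigma>. \<sigma> ` V h L \<subseteq> U}"
  have "finite (?I r)" if "r \<in> P" for r
  proof (cases r)
    case (Rule h L)
    have "finite {?f h L \<sigma> | \<sigma>. \<sigma> ` V h L \<subseteq> U}"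
    proof (rule finite_image_restricted_functions)
      show "finite (V h L)" using V that Rule by blast
      fix \<sigma> \<tau> :: "var \<Rightarrow> gterm" assume "\<And>x. x \<in> V h L \<Longrightarrow> \<sigma> x = \<tau> x"
      then show "?f h L \<sigma> = ?f h L \<tau>"
        using V[of h L] that Rule inst_lits_cong[of L \<sigma> \<tau>]
          inst_head_cong[of "vars_lits L" \<sigma> \<tau> h F ?D]
        by (metis subsetD)
    qed (rule U)
    then show ?thesis using Rule by simp
  qed
  moreover have "grnd F P \<subseteq> (\<Union>r\<in>P. ?I r)"
  proof
    fix r assume "r \<in> grnd F P"
    then obtain h L \<sigma> where h: "Rule h L \<in> P" "possible F ?D (inst_lits \<sigma> L)" "r = ?f h L \<sigma>"
      unfolding grnd_def instances_wrt_def by blast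
    then have "\<sigma> ` V h L \<subseteq> U" using V by blast
    then have "r \<in> ?I (Rule h L)" using h(3) by auto
    then show "r \<in> (\<Union>r\<in>P. ?I r)" using h(1) by blast
  qed
  ultimately have "finite (grnd F P)"
    using assms(1) by (meson finite_UN_I finite_subset)
  moreover have "finite_head (rule_head r)" if r: "r \<in> grnd F P" for r
  proof -
    from r obtain h L \<sigma> where h: "Rule h L \<in> P" "possible F ?D (inst_lits \<sigma> L)"
      "rule_head r = inst_head F ?D (vars_lits L) \<sigma> h"
      unfolding grnd_def instances_wrt_def by auto
    show ?thesis
    proof (cases h)
      case (Choice l E u)
      let ?g = "\<lambda>a M \<tau>. (inst_atom \<tau> a, inst_lits \<tau> M)"
      let ?J = "\<lambda>(a, M). {?g a M \<tau> | \<tau>. \<tau> ` (vars_atom a \<union> vars_lits M) \<subseteq> U}"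
      let ?H = "{(inst_atom \<tau> a, inst_lits \<tau> M) | a M \<tau>. (a, M) \<in> E \<and>
        (\<forall>x\<in>vars_lits L. \<tau> x = \<sigma> x) \<and> possible F ?D (inst_lits \<tau> M)}"
      have "?H \<subseteq> (\<Union>e\<in>E. ?J e)"
      proof clarify
        fix a M \<tau> assume e: "(a, M) \<in> E" "\<forall>x\<in>vars_lits L. \<tau> x = \<sigma> x"
          "possible F ?D (inst_lits \<tau> M)"
        have "inst_lits \<tau> L = inst_lits \<sigma> L" using e(2) by (intro inst_lits_cong) auto
        \<comment> \<open>Treating the element as a clause with body \<open>L @ M\<close> makes its
          head atom derivable, so the argument for normal rules applies to its local
          variables.\<close>
        then have p: "possible F ?D (inst_lits \<tau> (L @ M))" using h(2) e(3) by (simp del: map_eq_conv)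
        have "(a, L @ M) \<in> clauses (Rule h L)" using Choice e(1) by force
        then have "inst_atom \<tau> a \<in> ?D" using h(1) p by (blast intro: clause_derivable)
        moreover have "vars_lits M \<subseteq> vars_atom a \<union> pos_vars (L @ M)"
          using safe[OF h(1)] Choice e(1) by auto
        ultimately have "\<tau> ` (vars_atom a \<union> vars_lits M) \<subseteq> U"
          using atomU[of \<tau> a] posU[OF p] by blast
        then have "?g a M \<tau> \<in> ?J (a, M)" by auto
        then show "?g a M \<tau> \<in> (\<Union>e\<in>E. ?J e)" using e(1) by blast
      qed
      moreover have "finite (?J e)" for e
      proof (cases e)
        case (Pair a M)
        have "finite {?g a M \<tau> | \<tau>. \<tau> ` (vars_atom a \<union> vars_lits M) \<subseteq> U}"
        proof (rule finite_image_restricted_functions)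
          fix \<sigma> \<tau> :: "var \<Rightarrow> gterm"
          assume "\<And>x. x \<in> vars_atom a \<union> vars_lits M \<Longrightarrow> \<sigma> x = \<tau> x"
          then show "?g a M \<sigma> = ?g a M \<tau>"
            using inst_atom_cong[of a \<sigma> \<tau>] inst_lits_cong[of M \<sigma> \<tau>] by simp
        qed (simp_all add: finite_vars_atom finite_vars_lits U)
        then show ?thesis using Pair by simp
      qed
      moreover have "finite E" using safe[OF h(1)] Choice by simp
      ultimately have "finite ?H" by (meson finite_UN_I finite_subset)
      then show ?thesis using h(3) Choice by simp
    qed (use h(3) in auto)
  qed
  ultimately show ?thesis unfolding finite_program_def by blast
qed

section \<open>Skolem terms of bounded nesting\<close>

text \<open>A pair \<open>(R, V)\<close> acts as the name of a Skolem function, and the premise on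
  subterms is the oracle's ban on nesting that function in itself. Excluding compound
  \<open>R\<close> and \<open>V\<close> ensures that Skolem functions enter only through
  \<open>ts\<close>.\<close>

inductive_set skolem_terms :: "name set \<Rightarrow> (gterm \<times> gterm) set \<Rightarrow> nat \<Rightarrow> gterm set"
  for K Q m where
  const: "k \<in> K \<Longrightarrow> GCon k \<in> skolem_terms K Q m"
| skolem: "(R, V) \<in> Q \<Longrightarrow> length ts \<le> m \<Longrightarrow> \<forall>t\<in>set ts. t \<in> skolem_terms K Q m \<Longrightarrow>
    \<forall>t\<in>set ts. \<nexists>us. GFun STR ''s'' (R # V # us) \<in> subterms t \<Longrightarrow>
    \<forall>t\<in>{R, V}. \<nexists>f us. t = GFun f us \<Longrightarrow>
    GFun STR ''s'' (R # V # ts) \<in> skolem_terms K Q m"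

definition skolem_symbols :: "gterm \<Rightarrow> (gterm \<times> gterm) set" where
  "skolem_symbols t = {(R, V). \<exists>us. GFun STR ''s'' (R # V # us) \<in> subterms t}"

lemma subterms_non_Fun: "\<nexists>f us. t = GFun f us \<Longrightarrow> subterms t = {t}"
  by (cases t) auto

lemma skolem_symbols_skolem:
  assumes "\<forall>t\<in>{R, V}. \<nexists>f us. t = GFun f us"
  shows "skolem_symbols (GFun STR ''s'' (R # V # ts)) =
    insert (R, V) (\<Union>t\<in>set ts. skolem_symbols t)"
  using assms subterms_non_Fun[of R] subterms_non_Fun[of V]
  by (auto simp: skolem_symbols_def)

lemma skolem_symbols_subset: "t \<in> skolem_terms K Q m \<Longrightarrow> skolem_symbols t \<subseteq> Q"
proof (induction rule: skolem_terms.induct)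
  case (const k)
  then show ?case by (simp add: skolem_symbols_def)
next
  case (skolem R V ts)
  then show ?case by (subst skolem_symbols_skolem) auto
qed

text \<open>Induction on the finite set \<open>S\<close> of Skolem functions that may occur. The
  arguments of a term with root \<open>(R, V)\<close> avoid \<open>(R, V)\<close>, so they come from
  the finite collection for a proper subset of \<open>S\<close>, and there are at most
  \<open>m\<close> of them.\<close>

lemma finite_skolem_terms:
  assumes "finite K" and "finite Q"
  shows "finite (skolem_terms K Q m)"
proof -
  let ?T = "\<lambda>S. {t \<in> skolem_terms K Q m. skolem_symbols t \<subseteq> S}"
  have "finite (?T S)" if "finite S" for S
    using that
  proof (induction rule: finite_psubset_induct)
    case (psubset S)
    let ?A = "\<lambda>(R, V). (\<lambda>ts. GFun STR ''s'' (R # V # ts)) `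
      {ts. set ts \<subseteq> ?T (S - {(R, V)}) \<and> length ts \<le> m}"
    have "?T S \<subseteq> GCon ` K \<union> (\<Union>q\<in>S. ?A q)"
    proof
      fix t assume t: "t \<in> ?T S"
      then have "t \<in> skolem_terms K Q m" by simp
      then show "t \<in> GCon ` K \<union> (\<Union>q\<in>S. ?A q)"
      proof cases
        case (skolem R V ts)
        have S: "insert (R, V) (\<Union>t\<in>set ts. skolem_symbols t) \<subseteq> S"
          using t skolem skolem_symbols_skolem by auto
        moreover have "(R, V) \<notin> skolem_symbols u" if "u \<in> set ts" for u
          using skolem that by (auto simp: skolem_symbols_def)
        ultimately have "set ts \<subseteq> ?T (S - {(R, V)})" using skolem by auto
        then have "t \<in> ?A (R, V)" using skolem by auto
        then show ?thesis using S by blast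
      qed auto
    qed
    moreover have "finite (?A q)" if "q \<in> S" for q
    proof (cases q)
      case (Pair R V)
      then have "finite (?T (S - {(R, V)}))" using that by (intro psubset.IH) auto
      then show ?thesis using Pair by (auto intro: finite_lists_length_le)
    qed
    ultimately show ?case using assms(1) psubset.hyps
      by (meson finite_UN_I finite_UnI finite_imageI finite_subset)
  qed
  \<comment> \<open>For \<open>S = Q\<close> the restriction on occurring functions is
    vacuous.\<close>
  from this[OF assms(2)] show ?thesis
    by (rule finite_subset[rotated]) (use skolem_symbols_subset in blast)
qed

section \<open>The abduction program\<close>

definition constants :: "abduction_tuple \<Rightarrow> name set" where
  "constants A = (\<Union>ax\<in>axioms A. cons_axiom ax) \<union>
     (\<Union>p\<in>set (observation A). cons_fo p \<union> ex_const A ` vars_fo p)"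

definition axiom_atoms :: "abduction_tuple \<Rightarrow> fo_atom set" where
  "axiom_atoms A = (\<Union>ax\<in>axioms A. insert (hc_head ax) (set (hc_body ax)))"

text \<open>Skolem indices are counted from 1, so the closed bound
  \<open>length (ex_vars ax)\<close> reaches the last one. The bound 2 comes from the binary heads,
  which have at most two variable positions.\<close>

definition arg_terms :: "abduction_tuple \<Rightarrow> gterm set" where
  "arg_terms A = skolem_terms (constants A)
     (\<Union>ax\<in>axioms A. (\<lambda>i. (GCon (ident ax), GNum (int i))) ` {..length (ex_vars ax)}) 2"

definition c_terms :: "abduction_tuple \<Rightarrow> gterm set" where
  "c_terms A = (\<Union>p\<in>axiom_atoms A \<union> set (observation A).
     (\<lambda>ts. GFun STR ''c'' (GCon (pred p) # ts)) ` {ts. set ts \<subseteq> arg_terms A \<and> length ts = 2})"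

definition l_terms :: "abduction_tuple \<Rightarrow> gterm set" where
  "l_terms A = (\<Union>ax\<in>axioms A.
     GFun STR ''l'' ` {ts. set ts \<subseteq> arg_terms A \<and> length ts = length (ex_vars ax)})"

text \<open>A single set serves every argument position of every predicate; the identifiers are
  there for positions naming an axiom. The components of \<open>c\<close>- and
  \<open>l\<close>-terms stay in \<open>arg_terms A\<close>, so these terms never nest.\<close>

definition universe :: "abduction_tuple \<Rightarrow> gterm set" where
  "universe A = arg_terms A \<union> c_terms A \<union> l_terms A \<union> (GCon \<circ> ident) ` axioms A"

lemma vars_fo_eq_arg_vars: "vars_fo p = set (arg_vars p)"
  by (force simp: vars_fo_def arg_vars_def split: arg.splits)

lemma length_arg_vars_le: "length (arg_vars p) \<le> length (args p)"
proof -
  have "length (concat (map (\<lambda>a. case a of ArgVar x \<Rightarrow> [x] | ArgCon k \<Rightarrow> []) as)) \<le> length as" for as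
    by (induction as) (auto split: arg.split)
  then show ?thesis by (simp add: arg_vars_def)
qed

lemma set_ex_vars: "set (ex_vars ax) = vars_body ax - vars_fo (hc_head ax)"
  by (auto simp: ex_vars_def vars_body_def vars_fo_eq_arg_vars)

lemma finite_cons_fo: "finite (cons_fo p)"
proof -
  have "cons_fo p \<subseteq> (\<lambda>a. case a of ArgCon k \<Rightarrow> k) ` set (args p)"
    by (force simp: cons_fo_def)
  then show ?thesis by (rule finite_subset) simp
qed

lemma finite_constants: "abduction_instance A \<Longrightarrow> finite (constants A)"
  by (auto simp: abduction_instance_def constants_def cons_axiom_def finite_cons_fo vars_fo_eq_arg_vars)

lemma finite_arg_terms: "abduction_instance A \<Longrightarrow> finite (arg_terms A)"
  unfolding arg_terms_def
  by (rule finite_skolem_terms) (auto simp: finite_constants abduction_instance_def)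

lemma finite_universe:
  assumes "abduction_instance A"
  shows "finite (universe A)"
  using finite_arg_terms[OF assms] assms
  by (auto simp: universe_def c_terms_def l_terms_def axiom_atoms_def abduction_instance_def
      intro!: finite_lists_length_eq)

text \<open>The compound members of \<open>arg_terms A\<close> have root \<open>s\<close>, so the
  root symbol tells the parts of the universe apart. Facts about the components of a term can thus
  be read off from its membership.\<close>

lemma c_term_in_universe:
  "GFun STR ''c'' ts \<in> universe A \<longleftrightarrow> GFun STR ''c'' ts \<in> c_terms A"
  by (auto simp: universe_def l_terms_def arg_terms_def elim: skolem_terms.cases)

lemma l_term_in_universe:
  "GFun STR ''l'' ts \<in> universe A \<longleftrightarrow> GFun STR ''l'' ts \<in> l_terms A"
  by (auto simp: universe_def c_terms_def arg_terms_def elim: skolem_terms.cases)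

lemma inst_args_subset_iff:
  assumes "cons_fo p \<subseteq> constants A"
  shows "inst \<sigma> ` arg_term ` set (args p) \<subseteq> arg_terms A \<longleftrightarrow> \<sigma> ` vars_fo p \<subseteq> arg_terms A"
proof
  assume *: "inst \<sigma> ` arg_term ` set (args p) \<subseteq> arg_terms A"
  have "\<sigma> x \<in> arg_terms A" if "ArgVar x \<in> set (args p)" for x
  proof -
    have "inst \<sigma> (arg_term (ArgVar x)) \<in> arg_terms A" using * that by blast
    then show ?thesis by simp
  qed
  then show "\<sigma> ` vars_fo p \<subseteq> arg_terms A" by (auto simp: vars_fo_def)
next
  assume *: "\<sigma> ` vars_fo p \<subseteq> arg_terms A"
  have "inst \<sigma> (arg_term a) \<in> arg_terms A" if "a \<in> set (args p)" for a
  proof (cases a)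
    case (ArgVar x)
    then show ?thesis using * that by (auto simp: vars_fo_def)
  next
    case (ArgCon k)
    then have "k \<in> constants A" using assms that by (auto simp: cons_fo_def)
    then show ?thesis using ArgCon by (simp add: arg_terms_def skolem_terms.const)
  qed
  then show "inst \<sigma> ` arg_term ` set (args p) \<subseteq> arg_terms A" by auto
qed

text \<open>Constant arguments always lie in \<open>arg_terms A\<close>, so only variables matter.
  Left to right, this extracts variable values from a body atom; right to left, it places a new atom
  in the universe.\<close>

lemma enc_in_universe_iff:
  assumes "binary_atoms A" and p: "p \<in> axiom_atoms A"
  shows "inst \<sigma> (enc p) \<in> universe A \<longleftrightarrow> \<sigma> ` vars_fo p \<subseteq> arg_terms A"
proof -
  have "length (args p) = 2" using assms by (auto simp: binary_atoms_def axiom_atoms_def)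
  moreover have "cons_fo p \<subseteq> constants A"
    using p by (auto simp: axiom_atoms_def constants_def cons_axiom_def)
  ultimately show ?thesis
    using inst_args_subset_iff[of p A \<sigma>] p
    by (auto simp: enc_def c_term_in_universe c_terms_def image_image image_iff)
qed

lemma enc_goal_in_universe:
  assumes "binary_atoms A" and p: "p \<in> set (observation A)"
  shows "inst \<sigma> (enc_goal (ex_const A) p) \<in> universe A"
proof -
  have "inst \<sigma> (goal_arg (ex_const A) a) \<in> arg_terms A" if a: "a \<in> set (args p)" for a
  proof -
    obtain k where k: "inst \<sigma> (goal_arg (ex_const A) a) = GCon k" "k \<in> constants A"
    proof (cases a)
      case (ArgVar x)
      then have "x \<in> vars_fo p" using a by (simp add: vars_fo_def)
      then have "ex_const A x \<in> constants A" using p by (auto simp: constants_def)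
      then show ?thesis using ArgVar by (intro that[of "ex_const A x"]) auto
    next
      case (ArgCon k)
      then have "k \<in> cons_fo p" using a by (simp add: cons_fo_def)
      then have "k \<in> constants A" using p by (auto simp: constants_def)
      then show ?thesis using ArgCon by (intro that[of k]) auto
    qed
    then show ?thesis by (simp add: arg_terms_def skolem_terms.const)
  qed
  moreover have "length (args p) = 2" using assms by (auto simp: binary_atoms_def)
  ultimately have "map (inst \<sigma>) (map (goal_arg (ex_const A)) (args p))
      \<in> {ts. set ts \<subseteq> arg_terms A \<and> length ts = 2}" by auto
  then show ?thesis
    using p unfolding enc_goal_def inst.simps list.map c_term_in_universe c_terms_def by blast
qed

lemma vars_term_enc: "vars_term (enc p) = vars_fo p"
proof -
  have "vars_term (arg_term a) = {x. a = ArgVar x}" for a by (cases a) auto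
  then show ?thesis by (auto simp: enc_def vars_fo_def)
qed

section \<open>Shape of the program with external atoms\<close>

definition sk_rule :: "horn_clause \<Rightarrow> tm rule" where
  "sk_rule ax = (may_infer_via ax \<Leftarrow>
     Pos (Atom STR ''pot'' [enc (hc_head ax)]) #
     map (\<lambda>i. Ext STR ''sk_G1'' (Con (ident ax) # Num (int (i + 1)) # map Var (arg_vars (hc_head ax)))
       [Var (ex_vars ax ! i)]) [0..<length (ex_vars ax)])"

definition needs_rule :: "horn_clause \<Rightarrow> fo_atom \<Rightarrow> tm rule" where
  "needs_rule ax p = (Atom STR ''inferenceNeeds'' [enc (hc_head ax), Con (ident ax), enc p] \<Leftarrow>
     [Pos (may_infer_via ax)])"

lemma externalize_skolem_Un:
  "externalize_skolem f (P \<union> Q) = externalize_skolem f P \<union> externalize_skolem f Q"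
  by (auto simp: externalize_skolem_def)

lemma externalize_axiom_rules:
  "externalize_skolem STR ''sk_G1'' (axiom_rules ax) =
     insert (sk_rule ax) (needs_rule ax ` set (hc_body ax))"
proof -
  have "{Atom STR ''inferenceNeeds'' [enc (hc_head ax), Con (ident ax), enc p] \<Leftarrow>
        [Pos (may_infer_via ax)] | p. p \<in> set (hc_body ax)} = needs_rule ax ` set (hc_body ax)"
    by (auto simp: needs_rule_def)
  moreover have "externalize_skolem f (needs_rule ax ` S) = needs_rule ax ` S" for f S
    by (simp add: externalize_skolem_def needs_rule_def image_image)
  ultimately show ?thesis
    by (simp add: axiom_rules_def externalize_skolem_Un)
      (simp add: externalize_skolem_def sk_rule_def skolem_term_def comp_def)
qed

lemma externalize_facts: "externalize_skolem f ((\<lambda>x. a x \<Leftarrow> []) ` X) = (\<lambda>x. a x \<Leftarrow> []) ` X"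
  by (simp add: externalize_skolem_def image_image)

definition P_pot :: "tm program" where
  "P_pot = {Atom STR ''pot'' [Var STR ''X''] \<Leftarrow> [Pos (Atom STR ''goal'' [Var STR ''X''])],
      Atom STR ''pot'' [Var STR ''P''] \<Leftarrow>
        [Pos (Atom STR ''inferenceNeeds'' [Var STR ''_1'', Var STR ''_2'', Var STR ''P''])]}"

text \<open>The only comparisons in these bodies are \<open>NEQ\<close> and \<open>LESS\<close>,
  whereas \<open>replace_skolem\<close> changes only equations.\<close>

lemma externalize_fixed_rules:
  "externalize_skolem f (P_pot \<union> P_gp \<union> P_eq \<union> P_c) = P_pot \<union> P_gp \<union> P_eq \<union> P_c"
  by (simp add: externalize_skolem_def P_pot_def P_gp_def P_eq_def P_c_def Let_def image_Un)

lemma P_BwdA_G1_eq: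
  "P_BwdA_G1 A =
     (\<lambda>p. Atom STR ''goal'' [enc_goal (ex_const A) p] \<Leftarrow> []) ` set (observation A) \<union>
     (\<lambda>k. Atom STR ''sortname'' [Con k] \<Leftarrow> []) ` sort_names A \<union>
     (\<Union>ax\<in>axioms A. insert (sk_rule ax) (needs_rule ax ` set (hc_body ax))) \<union>
     (P_pot \<union> P_gp \<union> P_eq \<union> P_c)"
proof -
  have "P_BwdA A =
     (\<lambda>p. Atom STR ''goal'' [enc_goal (ex_const A) p] \<Leftarrow> []) ` set (observation A) \<union>
     (\<lambda>k. Atom STR ''sortname'' [Con k] \<Leftarrow> []) ` sort_names A \<union>
     (\<Union>ax\<in>axioms A. axiom_rules ax) \<union> (P_pot \<union> P_gp \<union> P_eq \<union> P_c)"
    unfolding P_BwdA_def P_bpt_def P_pot_def by (simp only: Setcompr_eq_image Un_assoc)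
  moreover have "externalize_skolem f (\<Union>ax\<in>axioms A. axiom_rules ax) =
      (\<Union>ax\<in>axioms A. externalize_skolem f (axiom_rules ax))" for f
    by (auto simp: externalize_skolem_def)
  ultimately show ?thesis
    unfolding P_BwdA_G1_def
    by (simp only: externalize_skolem_Un[of _ _ "P_pot \<union> P_gp \<union> P_eq \<union> P_c"]
        externalize_skolem_Un[of _ "_ ` _"] externalize_skolem_Un[of _ "_ \<union> _" "\<Union> _"]
        externalize_fixed_rules externalize_facts externalize_axiom_rules)
qed

lemma fixed_rules_weakly_safe: "r \<in> P_pot \<union> P_gp \<union> P_eq \<union> P_c \<Longrightarrow> weakly_safe r"
  by (auto simp: P_pot_def P_gp_def P_eq_def P_c_def Let_def pos_vars_def)

lemma finite_P_BwdA_G1: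
  assumes "abduction_instance A"
  shows "finite (P_BwdA_G1 A)"
proof -
  \<comment> \<open>Finiteness of the sort names is inherited from the constants of the
    axioms.\<close>
  have "sort_names A \<subseteq> constants A" using assms by (auto simp: abduction_instance_def constants_def)
  then have "finite (sort_names A)" using finite_constants[OF assms] by (rule finite_subset)
  then show ?thesis
    using assms
    by (simp add: P_BwdA_G1_eq abduction_instance_def P_pot_def P_gp_def P_eq_def P_c_def Let_def)
qed

lemma P_BwdA_G1_weakly_safe:
  assumes r: "r \<in> P_BwdA_G1 A"
  shows "weakly_safe r"
proof -
  have "weakly_safe (sk_rule ax)" for ax
  proof -
    \<comment> \<open>The invented variables are not in the positive body; they are covered by the
      \<open>l\<close>-term of the head, and the inputs of the oracle by the encoded head
      atom.\<close>
    have "vars_lits (map (\<lambda>i. Ext STR ''sk_G1''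
        (Con (ident ax) # Num (int (i + 1)) # map Var (arg_vars (hc_head ax)))
        [Var (ex_vars ax ! i)]) [0..<length (ex_vars ax)]) \<subseteq> vars_fo (hc_head ax) \<union> set (ex_vars ax)"
      by (auto simp: vars_lits_def vars_fo_eq_arg_vars)
    then show ?thesis
      by (auto simp: sk_rule_def may_infer_via_def vars_term_enc)
  qed
  moreover have "weakly_safe (needs_rule ax p)" for ax p
    by (auto simp: needs_rule_def pos_vars_def may_infer_via_def)
  ultimately show ?thesis
    using r fixed_rules_weakly_safe unfolding P_BwdA_G1_eq by auto
qed

section \<open>Closure of the universe under the rules\<close>

lemma fixed_rules_clauses:
  assumes "r \<in> P_pot \<union> P_gp \<union> P_eq \<union> P_c" and "(b, L) \<in> clauses r"
  shows "set_atom b \<subseteq> pos_args L \<or>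
    b = Atom STR ''hu'' [Var STR ''X''] \<and>
      (\<exists>t u. Fun STR ''c'' [t, Var STR ''X'', u] \<in> pos_args L \<or>
        Fun STR ''c'' [t, u, Var STR ''X''] \<in> pos_args L)"
  using assms by (auto simp: P_pot_def P_gp_def P_eq_def P_c_def Let_def)

text \<open>The \<open>pot\<close> atom places the oracle inputs in \<open>arg_terms A\<close>. The
  oracle then supplies the shape of each invented value and the absence of self-nesting, as the rule
  \<open>skolem_terms.skolem\<close> requires.\<close>

lemma sk_rule_closed:
  assumes A: "binary_atoms A" and ax: "ax \<in> axioms A"
    and D: "D = {a. set_atom a \<subseteq> universe A}"
    and b: "(b, L) \<in> clauses (sk_rule ax)" and L: "possible oracles D (inst_lits \<sigma> L)"
  shows "inst_atom \<sigma> b \<in> D"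
proof -
  let ?Ys = "map \<sigma> (arg_vars (hc_head ax))"
  have head: "hc_head ax \<in> axiom_atoms A" using ax by (auto simp: axiom_atoms_def)
  have enc: "inst \<sigma> (enc (hc_head ax)) \<in> universe A"
    using b L by (simp add: sk_rule_def D)
  then have Ys: "set ?Ys \<subseteq> arg_terms A"
    using enc_in_universe_iff[OF A head] by (simp add: vars_fo_eq_arg_vars)
  have len: "length ?Ys \<le> 2"
    using length_arg_vars_le[of "hc_head ax"] A ax by (auto simp: binary_atoms_def)
  have "\<sigma> (ex_vars ax ! i) \<in> arg_terms A" if i: "i < length (ex_vars ax)" for i
  proof -
    have "possible_lit oracles D (Ext STR ''sk_G1'' (GCon (ident ax) # GNum (int (i + 1)) # ?Ys)
        [\<sigma> (ex_vars ax ! i)])"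
      using b L i by (auto simp: sk_rule_def possible_def comp_def)
    \<comment> \<open>The oracle ignores the interpretation, so truth for some interpretation
      already yields its defining condition.\<close>
    then have sk: "\<sigma> (ex_vars ax ! i) = GFun STR ''s'' (GCon (ident ax) # GNum (int (i + 1)) # ?Ys)"
      "\<forall>Y\<in>set ?Ys. \<nexists>ts. GFun STR ''s'' (GCon (ident ax) # GNum (int (i + 1)) # ts) \<in> subterms Y"
      by (simp_all add: oracles_def)
    have "(GCon (ident ax), GNum (int (i + 1))) \<in>
        (\<Union>ax\<in>axioms A. (\<lambda>i. (GCon (ident ax), GNum (int i))) ` {..length (ex_vars ax)})"
      using ax i by (intro UN_I[OF ax] image_eqI[of _ _ "i + 1"]) auto
    then show ?thesis
      unfolding sk(1) arg_terms_def
      by (rule skolem_terms.skolem) (use len Ys sk(2) in \<open>auto simp: arg_terms_def\<close>)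
  qed
  then have "\<sigma> ` set (ex_vars ax) \<subseteq> arg_terms A" by (auto simp: in_set_conv_nth)
  then have "GFun STR ''l'' (map \<sigma> (ex_vars ax)) \<in> universe A"
    using ax unfolding l_term_in_universe l_terms_def by force
  moreover have "GCon (ident ax) \<in> universe A" using ax by (simp add: universe_def)
  ultimately show ?thesis
    using b enc by (simp add: sk_rule_def may_infer_via_def D comp_def)
qed

text \<open>Each variable of a body atom either occurs in the axiom head, and is bounded by the
  \<open>c\<close>-term, or is existential, and is bounded by the \<open>l\<close>-term of
  \<open>mayInferVia\<close>.\<close>

lemma needs_rule_closed:
  assumes A: "binary_atoms A" and ax: "ax \<in> axioms A" "p \<in> set (hc_body ax)"
    and D: "D = {a. set_atom a \<subseteq> universe A}"
    and b: "(b, L) \<in> clauses (needs_rule ax p)" and L: "possible oracles D (inst_lits \<sigma> L)"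
  shows "inst_atom \<sigma> b \<in> D"
proof -
  have atoms: "hc_head ax \<in> axiom_atoms A" "p \<in> axiom_atoms A"
    using ax by (auto simp: axiom_atoms_def)
  have univ: "inst \<sigma> (enc (hc_head ax)) \<in> universe A" "GCon (ident ax) \<in> universe A"
    "GFun STR ''l'' (map \<sigma> (ex_vars ax)) \<in> universe A"
    using b L by (simp_all add: needs_rule_def may_infer_via_def D comp_def)
  have "\<sigma> ` vars_fo (hc_head ax) \<subseteq> arg_terms A"
    using univ(1) enc_in_universe_iff[OF A atoms(1)] by simp
  moreover have "\<sigma> ` set (ex_vars ax) \<subseteq> arg_terms A"
    using univ(3) by (auto simp: l_term_in_universe l_terms_def)
  moreover have "vars_fo p \<subseteq> vars_fo (hc_head ax) \<union> set (ex_vars ax)"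
    using ax(2) by (auto simp: set_ex_vars vars_body_def)
  ultimately have "\<sigma> ` vars_fo p \<subseteq> arg_terms A" by blast
  then have "inst \<sigma> (enc p) \<in> universe A" using enc_in_universe_iff[OF A atoms(2)] by simp
  then show ?thesis using b univ(1,2) by (simp add: needs_rule_def D)
qed

text \<open>These rules copy arguments from positive body atoms, except those for \<open>hu\<close>,
  which take a component out of a \<open>c\<close>-term. That component lies in
  \<open>arg_terms A\<close>, again inside the universe.\<close>

lemma fixed_rules_closed:
  assumes r: "r \<in> P_pot \<union> P_gp \<union> P_eq \<union> P_c" and b: "(b, L) \<in> clauses r"
    and D: "D = {a. set_atom a \<subseteq> universe A}" and L: "possible F D (inst_lits \<sigma> L)"
  shows "inst_atom \<sigma> b \<in> D"
proof -
  have pos: "inst \<sigma> t \<in> universe A" if "t \<in> pos_args L" for t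
    using possible_pos_args[OF L that] D by auto
  have hu: "\<sigma> STR ''X'' \<in> universe A"
    if "Fun STR ''c'' [t, Var STR ''X'', u] \<in> pos_args L \<or>
        Fun STR ''c'' [t, u, Var STR ''X''] \<in> pos_args L"
    for t u
  proof -
    have "\<sigma> STR ''X'' \<in> arg_terms A"
      using that by (auto dest!: pos simp: c_term_in_universe c_terms_def)
    then show ?thesis by (simp add: universe_def)
  qed
  from fixed_rules_clauses[OF r b] show ?thesis
  proof
    assume "set_atom b \<subseteq> pos_args L"
    then show ?thesis using pos by (auto simp: D atom.set_map)
  next
    assume *: "b = Atom STR ''hu'' [Var STR ''X''] \<and>
      (\<exists>t u. Fun STR ''c'' [t, Var STR ''X'', u] \<in> pos_args L \<or>
        Fun STR ''c'' [t, u, Var STR ''X''] \<in> pos_args L)"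
    then have "\<sigma> STR ''X'' \<in> universe A" by (elim conjE exE) (rule hu)
    then show ?thesis using * by (simp add: D)
  qed
qed

lemma derivable_subset_universe:
  assumes A: "abduction_instance A" "binary_atoms A"
  shows "derivable oracles (P_BwdA_G1 A) \<subseteq> {a. set_atom a \<subseteq> universe A}"
proof (rule derivable_subset)
  let ?D = "{a. set_atom a \<subseteq> universe A}"
  fix r b L \<sigma>
  assume r: "r \<in> P_BwdA_G1 A" and b: "(b, L) \<in> clauses r"
    and L: "possible oracles ?D (inst_lits \<sigma> L)"
  from r consider (goal) p where "p \<in> set (observation A)"
      "r = (Atom STR ''goal'' [enc_goal (ex_const A) p] \<Leftarrow> [])"
    | (sort) k where "k \<in> sort_names A" "r = (Atom STR ''sortname'' [Con k] \<Leftarrow> [])"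
    | (sk) ax where "ax \<in> axioms A" "r = sk_rule ax"
    | (needs) ax p where "ax \<in> axioms A" "p \<in> set (hc_body ax)" "r = needs_rule ax p"
    | (fixed) "r \<in> P_pot \<union> P_gp \<union> P_eq \<union> P_c"
    unfolding P_BwdA_G1_eq by blast
  then show "inst_atom \<sigma> b \<in> ?D"
  proof cases
    case goal
    then show ?thesis using b enc_goal_in_universe[OF A(2)] by simp
  next
    case sort
    then have "k \<in> constants A" using A(1) by (auto simp: abduction_instance_def constants_def)
    then show ?thesis using b sort by (simp add: universe_def arg_terms_def skolem_terms.const)
  next
    case sk
    then show ?thesis using sk_rule_closed[OF A(2) sk(1) refl _ L] b by simp
  next
    case needs
    then show ?thesis using needs_rule_closed[OF A(2) needs(1,2) refl _ L] b by simp
  next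
    case fixed
    then show ?thesis using fixed_rules_closed[OF fixed b refl L] by simp
  qed
qed

theorem proposition7:
  fixes A :: abduction_tuple
  assumes "abduction_instance A"
    and "binary_atoms A"
  shows "finite_program (grnd oracles (P_BwdA_G1 A))"
proof -
  note P = finite_P_BwdA_G1[OF assms(1)] P_BwdA_G1_weakly_safe
  have "finite (derivable oracles (P_BwdA_G1 A))"
    \<comment> \<open>The finite set \<open>W\<close> of admissible arguments is
      \<open>universe A\<close>.\<close>
    by (rule finite_derivable[OF P finite_universe derivable_subset_universe])
      (assumption | rule assms)+
  then show ?thesis using finite_program_grnd[OF P] by simp
qed

end
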